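(* Let $\mathcal{M} \subseteq \mathbb{R}^{m\times n}$ be a linear subspace of dimension $d$, and let $\mathcal{B} = \{X_1^*,\dots,X_d^*\}$ be any output of the greedy procedure applied to $\mathcal{M}$. Then $\mathcal{B}$ solves the low-rank basis problem, i.e., it is a basis of $\mathcal{M}$ and $$\sum_{\ell=1}^d \operatorname{rank}(X_\ell^* ) = \min\Big\{ \sum_{\ell=1}^d \operatorname{rank}(X_\ell) : X_1,\dots,X_d\in\mathcal{M},\ \operatorname{span}\{X_1,\dots,X_d\} = \mathcal{M} \Big\}.$$ Moreover, any other basis $\{X_1,\dots,X_d\}$ of $\mathcal{M}$ attaining this minimum takes the same ranks up to permutation, i.e., there is a permutation $\pi$ of $\{1,\dots,d\}$ with $\operatorname{rank}(X_{\pi(\ell)}) = \operatorname{rank}(X_\ell^* )$ for all $\ell = 1,\dots,d$.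
   Context: Greedy procedure: given a $d$-dimensional subspace $\mathcal{M}\subseteq\mathbb{R}^{m\times n}$, start with $\mathcal{B}=\emptyset$. For $\ell=1,\dots,d$: choose a matrix $X_\ell^*\in\mathcal{M}$ of lowest possible rank among all matrices $X\in\mathcal{M}$ such that $\mathcal{B}\cup\{X\}=\{X_1^*,\dots,X_{\ell-1}^*,X\}$ is linearly independent (ties broken arbitrarily), and replace $\mathcal{B}$ by $\mathcal{B}\cup\{X_\ell^*\}$. The output is $\mathcal{B}=\{X_1^*,\dots,X_d^*\}$. Low-rank basis problem: minimize $\operatorname{rank}(X_1)+\dots+\operatorname{rank}(X_d)$ subject to $\operatorname{span}\{X_1,\dots,X_d\}=\mathcal{M}$. *)

theory Defs
  imports "HOL-Analysis.Analysis" "HOL-Combinatorics.Permutations"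
begin

text \<open>
  An \<open>m\<close>-by-\<open>n\<close> real matrix is an element of \<open>real ^ 'n ^ 'm\<close>. Families \<open>X\<^sub>1, \<dots>, X\<^sub>d\<close> are functions
  on \<open>nat\<close> of which only the values on \<open>{1..d}\<close> matter.
\<close>

definition lin_indep_family :: "nat set \<Rightarrow> (nat \<Rightarrow> real ^ 'n ^ 'm) \<Rightarrow> bool" where
  "lin_indep_family I X \<longleftrightarrow> inj_on X I \<and> independent (X ` I)"

definition basis_family :: "(real ^ 'n ^ 'm) set \<Rightarrow> nat \<Rightarrow> (nat \<Rightarrow> real ^ 'n ^ 'm) \<Rightarrow> bool" where
  "basis_family M d X \<longleftrightarrow> lin_indep_family {1..d} X \<and> span (X ` {1..d}) = M"

text \<open>
  In \<open>candidates\<close>, linear independence of \<open>X\<^sub>1, \<dots>, X\<^bsub>l-1\<^esub>, Y\<close> is that of the family: as sets,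
  \<open>{X\<^sub>1, \<dots>, X\<^bsub>l-1\<^esub>, Y}\<close> would also be independent when \<open>Y\<close> repeats an earlier matrix.
\<close>

definition candidates :: "(real ^ 'n ^ 'm) set \<Rightarrow> (nat \<Rightarrow> real ^ 'n ^ 'm) \<Rightarrow> nat \<Rightarrow> (real ^ 'n ^ 'm) set" where
  "candidates M X l = {Y \<in> M. lin_indep_family {1..l} (X(l := Y))}"

definition greedy_output :: "(real ^ 'n ^ 'm) set \<Rightarrow> nat \<Rightarrow> (nat \<Rightarrow> real ^ 'n ^ 'm) \<Rightarrow> bool" where
  "greedy_output M d X \<longleftrightarrow> (\<forall>l\<in>{1..d}. is_arg_min rank (\<lambda>Y. Y \<in> candidates M X l) (X l))"

definition rank_sum :: "nat \<Rightarrow> (nat \<Rightarrow> real ^ 'n ^ 'm) \<Rightarrow> nat" where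
  "rank_sum d X = (\<Sum>l=1..d. rank (X l))"

definition lrb_feasible :: "(real ^ 'n ^ 'm) set \<Rightarrow> nat \<Rightarrow> (nat \<Rightarrow> real ^ 'n ^ 'm) \<Rightarrow> bool" where
  "lrb_feasible M d X \<longleftrightarrow> (\<forall>l\<in>{1..d}. X l \<in> M) \<and> span (X ` {1..d}) = M"

definition solves_lrb :: "(real ^ 'n ^ 'm) set \<Rightarrow> nat \<Rightarrow> (nat \<Rightarrow> real ^ 'n ^ 'm) \<Rightarrow> bool" where
  "solves_lrb M d X \<longleftrightarrow> is_arg_min (rank_sum d) (lrb_feasible M d) X"

end

theory Submission
  imports Defs
begin

text \<open>
  For every \<open>r\<close>, the greedy matrices of rank at most \<open>r\<close> span all matrices of rank at most \<open>r\<close> in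
  \<open>M\<close>: at the first step choosing a matrix of rank above \<open>r\<close>, every matrix of rank at most \<open>r\<close> must
  already be in the span of the earlier choices. Hence any basis of \<open>M\<close> has, for every \<open>r\<close>, at least
  as many members of rank above \<open>r\<close> as the greedy one. Summing over \<open>r\<close> compares the rank sums, and
  equality of the sums forces equality for every \<open>r\<close>, that is, equality of the multisets of ranks.
\<close>

text \<open>Double counting of the pairs \<open>(i, r)\<close> with \<open>r < f i\<close>: each
  \<open>i\<close> occurs in exactly \<open>f i\<close> of them, one for each \<open>r\<close> below
  \<open>f i\<close>.\<close>

lemma sum_eq_sum_card_greater:
  fixes f :: "'a \<Rightarrow> nat"
  assumes "finite I" and "\<And>i. i \<in> I \<Longrightarrow> f i \<le> R"
  shows "sum f I = (\<Sum>r<R. card {i \<in> I. r < f i})"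
proof -
  have "sum f I = (\<Sum>i\<in>I. card {r \<in> {..<R}. r < f i})"
  proof (rule sum.cong [OF refl])
    fix i assume "i \<in> I"
    then have "{r \<in> {..<R}. r < f i} = {..<f i}" using assms(2) by force
    then show "f i = card {r \<in> {..<R}. r < f i}" by simp
  qed
  also have "\<dots> = (\<Sum>r<R. card {i \<in> I. r < f i})"
    using assms(1) by (intro sum_multicount_gen) auto
  finally show ?thesis .
qed

text \<open>Both sums split into counts over the same thresholds and are compared term by term. If
  the sums agree, so do all the counts, and these determine how often each value is taken.\<close>

lemma sum_mono_card_greater:
  fixes f g :: "'a \<Rightarrow> nat"
  assumes "finite I" and le: "\<And>r. card {i \<in> I. r < f i} \<le> card {i \<in> I. r < g i}"
  shows "sum f I \<le> sum g I"
    and "sum f I = sum g I \<Longrightarrow> \<exists>\<pi>. \<pi> permutes I \<and> (\<forall>i\<in>I. g (\<pi> i) = f i)"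
proof -
  \<comment> \<open>One bound for \<open>f\<close> and \<open>g\<close>, so that both sums run over
    the same thresholds; the inserted \<open>0\<close> covers empty \<open>I\<close>.\<close>
  define R where "R = Max (insert 0 (f ` I \<union> g ` I))"
  have fR: "f i \<le> R" and gR: "g i \<le> R" if "i \<in> I" for i
    unfolding R_def using that \<open>finite I\<close> by (auto intro!: Max_ge)
  have sf: "sum f I = (\<Sum>r<R. card {i \<in> I. r < f i})"
    using sum_eq_sum_card_greater [OF \<open>finite I\<close>] fR by blast
  have sg: "sum g I = (\<Sum>r<R. card {i \<in> I. r < g i})"
    using sum_eq_sum_card_greater [OF \<open>finite I\<close>] gR by blast
  show "sum f I \<le> sum g I"
    unfolding sf sg by (intro sum_mono le)
  assume "sum f I = sum g I"
  \<comment> \<open>Termwise inequalities whose sums agree are equalities.\<close>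
  then have eq_below: "card {i \<in> I. r < f i} = card {i \<in> I. r < g i}" if "r < R" for r
    using sum_mono_inv [of "\<lambda>r. card {i \<in> I. r < f i}" "{..<R}" "\<lambda>r. card {i \<in> I. r < g i}" r]
      sf sg le that by simp
  have eq: "card {i \<in> I. r < f i} = card {i \<in> I. r < g i}" for r
  proof (cases "r < R")
    case False
    then have "{i \<in> I. r < f i} = {}" "{i \<in> I. r < g i} = {}"
      using fR gR by fastforce+
    then show ?thesis by (simp only:)
  qed (rule eq_below)
  \<comment> \<open>For \<open>r = Suc s\<close> this is \<open>eq\<close> at threshold
    \<open>s\<close>; for \<open>r = 0\<close> both sets are \<open>I\<close>. The multiplicity of a
    value \<open>r\<close> is then the difference of two consecutive counts.\<close>
  have card_ge: "card {i \<in> I. r \<le> f i} = card {i \<in> I. r \<le> g i}" for r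
  proof (cases r)
    case (Suc s)
    then show ?thesis using eq [of s] by (simp only: Suc_le_eq)
  qed simp
  have card_eq: "card {i \<in> I. h i = r} = card {i \<in> I. r \<le> h i} - card {i \<in> I. r < h i}"
    for h :: "'a \<Rightarrow> nat" and r
  proof -
    have "{i \<in> I. h i = r} = {i \<in> I. r \<le> h i} - {i \<in> I. r < h i}" by auto
    then show ?thesis using \<open>finite I\<close> by (simp add: card_Diff_subset Collect_mono_iff)
  qed
  have "image_mset f (mset_set I) = image_mset g (mset_set I)"
  proof (rule multiset_eqI)
    fix r
    have "card {i \<in> I. f i = r} = card {i \<in> I. g i = r}"
      by (simp add: card_eq card_ge eq)
    then show "count (image_mset f (mset_set I)) r = count (image_mset g (mset_set I)) r"
      using \<open>finite I\<close> by (simp add: count_image_mset' eq_commute)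
  qed
  then obtain \<pi> where "\<pi> permutes I" "\<forall>i\<in>I. f i = g (\<pi> i)"
    using image_mset_eq_implies_permutes [OF \<open>finite I\<close>] by blast
  then show "\<exists>\<pi>. \<pi> permutes I \<and> (\<forall>i\<in>I. g (\<pi> i) = f i)" by force
qed

lemma greedy_output_step:
  assumes "greedy_output M d X" and "l \<in> {1..d}"
  shows "X l \<in> M" and "lin_indep_family {1..l} X"
    and "Y \<in> candidates M X l \<Longrightarrow> rank (X l) \<le> rank Y"
proof -
  have min: "is_arg_min rank (\<lambda>Y. Y \<in> candidates M X l) (X l)"
    using assms by (simp only: greedy_output_def)
  then have "X l \<in> candidates M X l" by (simp add: is_arg_min_def)
  then show "X l \<in> M" and "lin_indep_family {1..l} X"
    by (simp_all add: candidates_def)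
  show "rank (X l) \<le> rank Y" if "Y \<in> candidates M X l"
    using min that by (auto simp: is_arg_min_def not_less)
qed

lemma greedy_output_basis:
  assumes "subspace M" and "dim M = d" and "greedy_output M d X"
  shows "basis_family M d X"
proof -
  have ind: "lin_indep_family {1..d} X"
  \<comment> \<open>Independence of the whole family is what step \<open>l = d\<close> guarantees;
    for \<open>d = 0\<close> there is no step, and the family is empty.\<close>
  proof (cases "d = 0")
    case False
    then show ?thesis using greedy_output_step(2) [OF assms(3)] by simp
  qed (simp add: lin_indep_family_def independent_empty)
  moreover have "span (X ` {1..d}) = M"
  proof
    have sub: "X ` {1..d} \<subseteq> M" using greedy_output_step(1) [OF assms(3)] by auto
    then show "span (X ` {1..d}) \<subseteq> M" using assms(1) by (simp add: span_minimal)
    show "M \<subseteq> span (X ` {1..d})"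
      using card_ge_dim_independent [OF sub] ind assms(2)
      by (simp add: lin_indep_family_def card_image)
  qed
  ultimately show ?thesis by (simp add: basis_family_def)
qed

text \<open>The number of distinct members is squeezed between the dimension \<open>d\<close> of
  their span and the number \<open>d\<close> of indices, which excludes both repetitions and
  dependence.\<close>

lemma lrb_feasible_imp_basis_family:
  assumes "dim M = d" and "lrb_feasible M d Y"
  shows "basis_family M d Y"
proof -
  have spn: "span (Y ` {1..d}) = M" using assms(2) by (simp add: lrb_feasible_def)
  then have "d = dim (Y ` {1..d})" using assms(1) by (metis dim_span)
  moreover have "dim (Y ` {1..d}) \<le> card (Y ` {1..d})" by (simp add: dim_le_card')
  moreover have "card (Y ` {1..d}) \<le> d" using card_image_le [of "{1..d}" Y] by simp
  ultimately have card: "card (Y ` {1..d}) = d" and "dim (Y ` {1..d}) = d" by auto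
  then have "independent (Y ` {1..d})"
    by (intro card_le_dim_spanning [of _ "span (Y ` {1..d})"]) (auto intro: span_base)
  moreover have "inj_on Y {1..d}" using card by (simp add: eq_card_imp_inj_on)
  ultimately show ?thesis using spn by (simp add: basis_family_def lin_indep_family_def)
qed

lemma basis_family_imp_lrb_feasible:
  "basis_family M d X \<Longrightarrow> lrb_feasible M d X"
  by (auto simp: basis_family_def lrb_feasible_def intro: span_base)

lemma greedy_output_span_low_rank:
  assumes "subspace M" and "dim M = d" and X: "greedy_output M d X"
    and A: "A \<in> M" "rank A \<le> r"
  shows "A \<in> span (X ` {l \<in> {1..d}. rank (X l) \<le> r})"
proof (cases "\<forall>l\<in>{1..d}. rank (X l) \<le> r")
  case True
  then have "{l \<in> {1..d}. rank (X l) \<le> r} = {1..d}" by auto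
  then show ?thesis
    using greedy_output_basis [OF assms(1-3)] A by (simp add: basis_family_def)
next
  case False
  then have "\<exists>l. l \<in> {1..d} \<and> r < rank (X l)" by (auto simp: not_le)
  then obtain k where k: "k \<in> {1..d}" "r < rank (X k)"
    and least: "\<And>l. l < k \<Longrightarrow> \<not> (l \<in> {1..d} \<and> r < rank (X l))"
    using exists_least_iff [of "\<lambda>l. l \<in> {1..d} \<and> r < rank (X l)"] by blast
  \<comment> \<open>By minimality of \<open>k\<close>, all choices before step \<open>k\<close> have
    rank at most \<open>r\<close>, so it suffices that they span \<open>A\<close>.\<close>
  have "{1..<k} \<subseteq> {l \<in> {1..d}. rank (X l) \<le> r}"
    using k least by (force simp: not_less)
  moreover have "A \<in> span (X ` {1..<k})"
  proof (rule ccontr)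
    assume notin: "A \<notin> span (X ` {1..<k})"
    have "lin_indep_family {1..k} X" using greedy_output_step(2) [OF X k(1)] .
    then have ind: "inj_on X {1..<k}" "independent (X ` {1..<k})"
      unfolding lin_indep_family_def
      by (auto elim!: inj_on_subset independent_mono)
    \<comment> \<open>\<open>X(k := A)\<close> agrees with \<open>X\<close> before \<open>k\<close>,
      so its independence reduces to \<open>A\<close> lying outside the span of the earlier choices.
      Then \<open>A\<close> competes at step \<open>k\<close> with rank below that of
      \<open>X k\<close>.\<close>
    have eq: "{1..k} = insert k {1..<k}" using k(1) by auto
    have upd: "(X(k := A)) ` {1..<k} = X ` {1..<k}" by auto
    have "inj_on (X(k := A)) {1..<k}" using ind(1) by (simp add: inj_on_def)
    moreover have "A \<notin> X ` {1..<k}" using notin span_base [of A "X ` {1..<k}"] by argo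
    moreover have "{1..<k} - {k} = {1..<k}" by auto
    moreover have "independent (insert A (X ` {1..<k}))"
      using ind(2) notin by (rule independent_insertI [rotated])
    ultimately have "lin_indep_family {1..k} (X(k := A))"
      unfolding lin_indep_family_def eq image_insert inj_on_insert upd
      by (simp only: fun_upd_same upd) simp
    then have "A \<in> candidates M X k" using A by (simp add: candidates_def)
    then show False using greedy_output_step(3) [OF X k(1)] k(2) A(2) by fastforce
  qed
  ultimately show ?thesis by (meson image_mono span_mono subsetD)
qed

text \<open>The low-rank members of \<open>Y\<close> are independent and lie in the span of the
  low-rank greedy matrices, so there are at most as many of them. Passing to complements in
  \<open>{1..d}\<close> reverses the inequality.\<close>

lemma greedy_output_card_high_rank_le:
  fixes X Y :: "nat \<Rightarrow> real ^ 'n ^ 'm"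
  assumes "subspace M" and "dim M = d" and X: "greedy_output M d X"
    and Y: "basis_family M d Y"
  shows "card {l \<in> {1..d}. r < rank (X l)} \<le> card {l \<in> {1..d}. r < rank (Y l)}"
proof -
  let ?low = "\<lambda>Z. {l \<in> {1..d}. rank (Z l) \<le> r}"
  have Yi: "inj_on Y {1..d}" "independent (Y ` {1..d})" and YM: "\<And>l. l \<in> {1..d} \<Longrightarrow> Y l \<in> M"
    using Y by (auto simp: basis_family_def lin_indep_family_def intro: span_base)
  have "Y ` ?low Y \<subseteq> span (X ` ?low X)"
    using greedy_output_span_low_rank [OF assms(1-3)] YM by blast
  moreover have "independent (Y ` ?low Y)"
    using Yi(2) by (rule independent_mono) auto
  ultimately have "card (Y ` ?low Y) \<le> card (X ` ?low X)"
    using independent_span_bound [of "X ` ?low X" "Y ` ?low Y"] by simp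
  moreover have "card (Y ` ?low Y) = card (?low Y)"
    by (intro card_image inj_on_subset [OF Yi(1)]) auto
  moreover have "card (X ` ?low X) \<le> card (?low X)" by (simp add: card_image_le)
  ultimately have "card (?low Y) \<le> card (?low X)" by simp
  moreover have "card {l \<in> {1..d}. r < rank (Z l)} = d - card (?low Z)"
    for Z :: "nat \<Rightarrow> real ^ 'n ^ 'm"
  proof -
    have "{l \<in> {1..d}. r < rank (Z l)} = {1..d} - ?low Z" by auto
    moreover have "card ({1..d} - ?low Z) = d - card (?low Z)"
      by (subst card_Diff_subset) auto
    ultimately show ?thesis by simp
  qed
  ultimately show ?thesis by simp
qed

theorem corollary3:
  fixes M :: "(real ^ 'n ^ 'm) set" and d :: nat and X :: "nat \<Rightarrow> real ^ 'n ^ 'm"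
  assumes "subspace M" and "dim M = d" and "greedy_output M d X"
  shows "basis_family M d X
    \<and> solves_lrb M d X
    \<and> (\<Sum>l=1..d. rank (X l))
        = Min {\<Sum>l=1..d. rank (Y l) | Y. (\<forall>l\<in>{1..d}. Y l \<in> M) \<and> span (Y ` {1..d}) = M}
    \<and> (\<forall>Y. basis_family M d Y \<and> solves_lrb M d Y \<longrightarrow>
          (\<exists>\<pi>. \<pi> permutes {1..d} \<and> (\<forall>l\<in>{1..d}. rank (Y (\<pi> l)) = rank (X l))))"
proof (intro conjI allI impI)
  show "basis_family M d X" using greedy_output_basis [OF assms] .
  then have feas: "lrb_feasible M d X" by (rule basis_family_imp_lrb_feasible)
  have le: "rank_sum d X \<le> rank_sum d Y" if "lrb_feasible M d Y" for Y
    unfolding rank_sum_def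
    using greedy_output_card_high_rank_le [OF assms lrb_feasible_imp_basis_family]
      that assms(2)
    by (intro sum_mono_card_greater(1)) auto
  then show "solves_lrb M d X"
    using feas by (auto simp: solves_lrb_def is_arg_min_def not_less)
  let ?S = "{\<Sum>l=1..d. rank (Y l) | Y. (\<forall>l\<in>{1..d}. Y l \<in> M) \<and> span (Y ` {1..d}) = M}"
  have S: "?S = rank_sum d ` Collect (lrb_feasible M d)"
    by (auto simp: rank_sum_def lrb_feasible_def)
  \<comment> \<open>\<open>Min\<close> is meaningful only on a finite set. There may be infinitely
    many feasible families, but their rank sums are bounded natural numbers, as no rank exceeds the
    number of columns.\<close>
  have "rank_sum d Y \<le> d * CARD('n)" for Y :: "nat \<Rightarrow> real ^ 'n ^ 'm"
    unfolding rank_sum_def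
    using sum_bounded_above [of "{1..d}" "\<lambda>l. rank (Y l)" "CARD('n)"] rank_bound
    by fastforce
  then have "finite ?S"
    unfolding S by (subst finite_nat_set_iff_bounded_le) blast
  then have "Min ?S = rank_sum d X"
    unfolding S using le feas by (intro Min_eqI) auto
  then show "(\<Sum>l=1..d. rank (X l)) = Min ?S"
    by (simp only: rank_sum_def)
  fix Y assume Y: "basis_family M d Y \<and> solves_lrb M d Y"
  \<comment> \<open>Optimality of \<open>Y\<close> is tested against the feasible \<open>X\<close>;
    together with \<open>le\<close> this gives equal sums, the equality case of the counting
    lemma.\<close>
  then have "lrb_feasible M d Y" and "\<not> rank_sum d X < rank_sum d Y"
    using feas by (auto simp: solves_lrb_def is_arg_min_def)
  then have "rank_sum d X = rank_sum d Y" using le by force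
  then show "\<exists>\<pi>. \<pi> permutes {1..d} \<and> (\<forall>l\<in>{1..d}. rank (Y (\<pi> l)) = rank (X l))"
    unfolding rank_sum_def
    using greedy_output_card_high_rank_le [OF assms] Y
    by (intro sum_mono_card_greater(2)) auto
qed

end
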